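(* For $r=0,1,2$, let $G_r$ be a $k_r$-regular graph of order $n_r$ with adjacency eigenvalues $k_r=\lambda_{r1}\ge\lambda_{r2}\ge\cdots\ge\lambda_{rn_r}$. Then the eigenvalues (with multiplicity) of the distance Seidel matrix of $G_0\vee(G_1\cup G_2)$ are $3+2\lambda_{rt}$ for $t=2,\dots,n_r$ and $r=0,1,2$, together with the three eigenvalues of the matrix $$\begin{bmatrix}3-3n_0+2k_0&-n_1&-n_2\\-n_0&3-3n_1+2k_1&-3n_2\\-n_0&-3n_1&3-3n_2+2k_2\end{bmatrix}.$$
   Context: $G_1\cup G_2$ is the disjoint union; the join $H_1\vee H_2$ of vertex-disjoint graphs is obtained from $H_1\cup H_2$ by adding all edges between $H_1$ and $H_2$. For a connected graph $G$ with distance matrix $\mathcal{D}(G)$, the distance Seidel matrix is $\mathcal{D}^S(G)=J-I-2\mathcal{D}(G)$, $J$ the all-ones matrix. *)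

theory Defs
  imports
    Complex_Main
    "HOL-Library.Multiset"
    "HOL-Computational_Algebra.Polynomial"
    "Graph_Theory.Graph_Theory"
    "Jordan_Normal_Form.Char_Poly"
begin

text \<open>
  Finite simple graphs are those of the locale \<^locale>\<open>pair_graph\<close>: a finite vertex
  set with a symmetric, irreflexive arc relation (each edge counts as two opposite arcs, so the
  degree of a vertex is its out-degree).
\<close>

definition regular_graph :: "nat \<Rightarrow> 'a pair_pre_digraph \<Rightarrow> bool" where
  "regular_graph k G \<longleftrightarrow> (\<forall>v\<in>pverts G. out_degree (with_proj G) v = k)"

text \<open>
  Union and join are meant for vertex-disjoint graphs; disjointness is a hypothesis wherever they
  are used.
\<close>

definition graph_union :: "'a pair_pre_digraph \<Rightarrow> 'a pair_pre_digraph \<Rightarrow> 'a pair_pre_digraph" where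
  "graph_union G H = \<lparr> pverts = pverts G \<union> pverts H, parcs = parcs G \<union> parcs H \<rparr>"

lemma with_proj_graph_union:
  "with_proj (graph_union G H) = Digraph_Component.union (with_proj G) (with_proj H)"
  by (simp add: with_proj_def graph_union_def Digraph_Component.union_def)

definition graph_join :: "'a pair_pre_digraph \<Rightarrow> 'a pair_pre_digraph \<Rightarrow> 'a pair_pre_digraph" where
  "graph_join G H = \<lparr> pverts = pverts (graph_union G H),
     parcs = parcs (graph_union G H) \<union> pverts G \<times> pverts H \<union> pverts H \<times> pverts G \<rparr>"

text \<open>
  Length of a shortest walk. If \<open>u\<close> and \<open>v\<close> are not connected, \<^term>\<open>real_of_ereal\<close>
  turns the infinite distance into 0, so this is meaningful for connected graphs only.
\<close>

definition graph_dist :: "'a pair_pre_digraph \<Rightarrow> 'a \<Rightarrow> 'a \<Rightarrow> real" where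
  "graph_dist G u v = real_of_ereal (wf_digraph.\<mu> (with_proj G) (\<lambda>_. 1) u v)"

text \<open>Rows and columns of the matrices of a graph are ordered by an enumeration of its vertices.\<close>

definition vertex_enum :: "'a pair_pre_digraph \<Rightarrow> 'a list \<Rightarrow> bool" where
  "vertex_enum G vs \<longleftrightarrow> distinct vs \<and> set vs = pverts G"

definition adjacency_matrix :: "'a list \<Rightarrow> 'a pair_pre_digraph \<Rightarrow> real mat" where
  "adjacency_matrix vs G =
     mat (length vs) (length vs) (\<lambda>(i, j). if (vs ! i, vs ! j) \<in> parcs G then 1 else 0)"

definition distance_matrix :: "'a list \<Rightarrow> 'a pair_pre_digraph \<Rightarrow> real mat" where
  "distance_matrix vs G = mat (length vs) (length vs) (\<lambda>(i, j). graph_dist G (vs ! i) (vs ! j))"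

definition distance_seidel_matrix :: "'a list \<Rightarrow> 'a pair_pre_digraph \<Rightarrow> real mat" where
  "distance_seidel_matrix vs G =
     mat (length vs) (length vs) (\<lambda>_. 1) - 1\<^sub>m (length vs) - 2 \<cdot>\<^sub>m distance_matrix vs G"

text \<open>
  All complex eigenvalues with algebraic multiplicity, so that none is lost for a real matrix
  that is not symmetric.
\<close>

definition eigenvalue_mset :: "real mat \<Rightarrow> complex multiset" where
  "eigenvalue_mset A = proots (char_poly (map_mat complex_of_real A))"

end

theory Submission
  imports Defs "Jordan_Normal_Form.Schur_Decomposition"
begin

text \<open>
  All distances in the join are at most 2, so its distance Seidel matrix is $X + U W$, where
  $X = 3 I + 2 A$ for the adjacency matrix $A$ of the disjoint union of the three graphs,
  $U$ has the indicator vectors of the three vertex sets as columns, and $W$ is constant on blocks.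
  By regularity $X U = U Y$ with the diagonal $3 \times 3$ matrix $Y$ of entries $3 + 2 k_r$.
  Whenever $X U = U Y$, the matrices satisfy
  $\chi(X + U W) \chi(Y) = \chi(X) \chi(Y + W U)$ for the characteristic polynomial $\chi$. Here
  $Y + W U$ is the quotient matrix of the statement, and cancelling $\chi(Y)$ removes the
  eigenvalues $3 + 2 k_r$ from those of $X$.
\<close>

section \<open>Characteristic polynomials\<close>

text \<open>Subtracting from a multiple of the identity preserves the block triangular shape;
  \<open>C\<close> contributes only constant polynomials below the diagonal, and the determinant
  factors.\<close>

lemma char_poly_four_block_upper_right_zero:
  fixes A D :: "'a :: idom mat"
  assumes A: "A \<in> carrier_mat n n" and C: "C \<in> carrier_mat m n" and D: "D \<in> carrier_mat m m"
  shows "char_poly (four_block_mat A (0\<^sub>m n m) C D) = char_poly A * char_poly D"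
proof -
  have "char_poly_matrix (four_block_mat A (0\<^sub>m n m) C D) =
      four_block_mat (char_poly_matrix A) (0\<^sub>m n m) (map_mat (\<lambda>a. [:- a:]) C) (char_poly_matrix D)"
    using A C D by (intro eq_matI) (auto simp: char_poly_matrix_def one_poly_def)
  then show ?thesis
    unfolding char_poly_def
    using det_four_block_mat_upper_right_zero[of "char_poly_matrix A" n "0\<^sub>m n m" m
        "map_mat (\<lambda>a. [:- a:]) C" "char_poly_matrix D"] A C D
    by simp
qed

text \<open>
  Conjugation by the block matrix with rows $(I, U)$ and $(0, I)$ turns the block lower triangular
  matrix with rows $(X, 0)$, $(W, Y + W U)$ into the one with rows $(X + U W, 0)$, $(W, Y)$.
\<close>

lemma char_poly_intertwine:
  fixes X Y :: "'a :: idom mat"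
  assumes X: "X \<in> carrier_mat n n" and Y: "Y \<in> carrier_mat m m"
    and U: "U \<in> carrier_mat n m" and W: "W \<in> carrier_mat m n"
    and XU: "X * U = U * Y"
  shows "char_poly (X + U * W) * char_poly Y = char_poly X * char_poly (Y + W * U)"
proof -
  let ?L = "four_block_mat (X + U * W) (0\<^sub>m n m) W Y"
  let ?R = "four_block_mat X (0\<^sub>m n m) W (Y + W * U)"
  let ?P = "four_block_mat (1\<^sub>m n) U (0\<^sub>m m n) (1\<^sub>m m)"
  let ?Q = "four_block_mat (1\<^sub>m n) (- U) (0\<^sub>m m n) (1\<^sub>m m)"
  have UW: "U * W \<in> carrier_mat n n" and WU: "W * U \<in> carrier_mat m m"
    and UY: "U * Y \<in> carrier_mat n m"
    using U W Y by auto
  have PQ: "?P * ?Q = 1\<^sub>m (n + m)" "?Q * ?P = 1\<^sub>m (n + m)"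
    using U by (subst mult_four_block_mat[of _ n n _ m _ m _ _ n _ m]; auto intro!: eq_matI)+
  have PR: "?P * ?R = four_block_mat (X + U * W) (U * (Y + W * U)) W (Y + W * U)"
    using X Y U W
    by (subst mult_four_block_mat[of _ n n _ m _ m _ _ n _ m]) auto
  \<comment> \<open>The upper right block of the conjugated matrix. It is
    \<open>U * Y - X * U\<close> after the two copies of \<open>U * W * U\<close> cancel, so
    \<open>XU\<close> is exactly what makes it vanish.\<close>
  have "(X + U * W) * (- U) + U * (Y + W * U) = 0\<^sub>m n m"
  proof -
    have "(X + U * W) * (- U) = - (U * Y + U * (W * U))"
      using X U W UW XU
      by (simp add: uminus_mult_right_mat add_mult_distrib_mat[of _ n n _ _ m]
          assoc_mult_mat[of _ n m _ n _ m])
    moreover have "U * (Y + W * U) = U * Y + U * (W * U)"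
      using U Y WU by (rule mult_add_distrib_mat)
    ultimately show ?thesis
      using U UY WU by (auto intro!: eq_matI)
  qed
  moreover have "W * (- U) + (Y + W * U) = Y"
    using W U Y WU by (auto intro!: eq_matI)
  ultimately have "?P * ?R * ?Q = ?L"
    unfolding PR using X Y U W
    by (subst mult_four_block_mat[of _ n n _ m _ m _ _ n _ m]) auto
  moreover have "{?L, ?R, ?P, ?Q} \<subseteq> carrier_mat (n + m) (n + m)"
    using X Y U W by auto
  ultimately have "similar_mat ?L ?R"
    using PQ by (intro similar_matI[of _ _ ?P ?Q "n + m"]) auto
  then have "char_poly ?L = char_poly ?R"
    by (rule char_poly_similar)
  then show ?thesis
    using X Y U W UW WU by (simp add: char_poly_four_block_upper_right_zero)
qed

lemma eigenvalue_mset_eq: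
  "A \<in> carrier_mat n n \<Longrightarrow> eigenvalue_mset A = proots (map_poly complex_of_real (char_poly A))"
  by (simp add: eigenvalue_mset_def of_real_hom.char_poly_hom)

text \<open>A characteristic polynomial is monic. Nonzero factors are required for
  \<open>proots\<close> to turn products into sums of multisets.\<close>

lemma map_poly_char_poly_nonzero:
  "A \<in> carrier_mat n n \<Longrightarrow> map_poly complex_of_real (char_poly A) \<noteq> 0"
  using degree_monic_char_poly[of "map_mat complex_of_real A" n]
  by (auto simp flip: of_real_hom.char_poly_hom)

lemma proots_char_poly_mult:
  assumes "A \<in> carrier_mat n n" "B \<in> carrier_mat m m"
  shows "proots (map_poly complex_of_real (char_poly A * char_poly B)) =
    eigenvalue_mset A + eigenvalue_mset B"
proof -
  interpret map_poly_comm_ring_hom complex_of_real ..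
  show ?thesis
    using assms map_poly_char_poly_nonzero[of A n] map_poly_char_poly_nonzero[of B m]
    by (simp add: eigenvalue_mset_eq hom_mult proots_mult)
qed

lemma proots_prod_list_linear:
  "proots (\<Prod>a\<leftarrow>as. [:- a, 1:]) = mset (as :: 'a :: idom list)"
  by (induction as) (auto simp: proots_mult prod_list_zero_iff image_iff simp del: mult_pCons_left)

text \<open>Over the complex numbers the matrix is similar to an upper triangular \<open>B\<close>.
  The same conjugation carries the affine image of the matrix to that of \<open>B\<close>, which is
  still triangular, so the map acts on the diagonal entries and multiplicities are kept.\<close>

lemma eigenvalue_mset_affine:
  assumes A: "A \<in> carrier_mat n n"
  shows "eigenvalue_mset (c \<cdot>\<^sub>m 1\<^sub>m n + d \<cdot>\<^sub>m A) =
    image_mset (\<lambda>x. of_real c + of_real d * x) (eigenvalue_mset A)"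
proof -
  let ?A = "map_mat complex_of_real A"
  let ?f = "\<lambda>x. complex_of_real c + complex_of_real d * x"
  let ?aff = "\<lambda>M. complex_of_real c \<cdot>\<^sub>m 1\<^sub>m n + complex_of_real d \<cdot>\<^sub>m M"
  have A': "?A \<in> carrier_mat n n"
    using A by simp
  \<comment> \<open>Schur decomposition needs a characteristic polynomial that splits into linear
    factors.\<close>
  obtain as where "char_poly ?A = (\<Prod>a\<leftarrow>as. [:- a, 1:])"
    using char_poly_factorized[OF A'] by blast
  then obtain B where B: "B \<in> carrier_mat n n" "upper_triangular B" and sim: "similar_mat ?A B"
    using schur_decomposition_exists[OF A'] by blast
  obtain P Q where wit: "similar_mat_wit ?A B P Q"
    using sim unfolding similar_mat_def by blast
  note PQ = similar_mat_witD2[OF A' wit]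
  have "P * ?aff B * Q = ?aff ?A"
  proof -
    have "P * ?aff B = of_real c \<cdot>\<^sub>m P + of_real d \<cdot>\<^sub>m (P * B)"
      using PQ B by (simp add: mult_add_distrib_mat[of _ n n _ n] mult_smult_distrib[of _ n n _ n])
    also have "\<dots> * Q = of_real c \<cdot>\<^sub>m (P * Q) + of_real d \<cdot>\<^sub>m (P * B * Q)"
      using PQ B by (simp add: add_mult_distrib_mat[of _ n n _ _ n] mult_smult_assoc_mat[of _ n n _ n])
    also have "\<dots> = ?aff ?A"
      using PQ by simp
    finally show ?thesis .
  qed
  then have "similar_mat (?aff ?A) (?aff B)"
    using PQ B by (intro similar_matI[of _ _ P Q n]) auto
  moreover have "map_mat complex_of_real (c \<cdot>\<^sub>m 1\<^sub>m n + d \<cdot>\<^sub>m A) = ?aff ?A"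
    using A by (auto intro!: eq_matI)
  ultimately have "eigenvalue_mset (c \<cdot>\<^sub>m 1\<^sub>m n + d \<cdot>\<^sub>m A) = proots (char_poly (?aff B))"
    by (simp add: eigenvalue_mset_def char_poly_similar)
  also have "\<dots> = mset (diag_mat (?aff B))"
    using B by (subst char_poly_upper_triangular[of _ n])
      (auto simp: proots_prod_list_linear upper_triangular_def)
  also have "diag_mat (?aff B) = map ?f (diag_mat B)"
    using B by (auto simp: diag_mat_def)
  also have "mset \<dots> = image_mset ?f (mset (diag_mat B))"
    by simp
  also have "mset (diag_mat B) = eigenvalue_mset A"
    using B sim by (simp add: eigenvalue_mset_def char_poly_similar[OF sim]
        char_poly_upper_triangular[of _ n] proots_prod_list_linear)
  finally show ?thesis .
qed

section \<open>Matrices indexed by lists\<close>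

text \<open>Entries depend on vertices or block labels instead of positions; a list only fixes the
  order of an index set. Matrix identities thereby become identities between functions.\<close>

definition fun_mat :: "'a list \<Rightarrow> 'b list \<Rightarrow> ('a \<Rightarrow> 'b \<Rightarrow> 'c) \<Rightarrow> 'c mat" where
  "fun_mat xs ys f = mat (length xs) (length ys) (\<lambda>(i, j). f (xs ! i) (ys ! j))"

lemma fun_mat_carrier [simp]: "fun_mat xs ys f \<in> carrier_mat (length xs) (length ys)"
  and dim_fun_mat [simp]: "dim_row (fun_mat xs ys f) = length xs" "dim_col (fun_mat xs ys f) = length ys"
  and index_fun_mat [simp]:
    "i < length xs \<Longrightarrow> j < length ys \<Longrightarrow> fun_mat xs ys f $$ (i, j) = f (xs ! i) (ys ! j)"
  by (simp_all add: fun_mat_def)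

lemma fun_mat_cong:
  "(\<And>x y. x \<in> set xs \<Longrightarrow> y \<in> set ys \<Longrightarrow> f x y = g x y) \<Longrightarrow> fun_mat xs ys f = fun_mat xs ys g"
  by (intro eq_matI) auto

lemma fun_mat_add: "fun_mat xs ys f + fun_mat xs ys g = fun_mat xs ys (\<lambda>x y. f x y + g x y)"
  by (intro eq_matI) auto

text \<open>Since \<open>ys\<close> has no repetitions, its positions correspond bijectively to its
  elements, and the scalar product becomes a sum over a set.\<close>

lemma fun_mat_mult:
  assumes "distinct ys"
  shows "fun_mat xs ys f * fun_mat ys zs g =
    fun_mat xs zs (\<lambda>x z. \<Sum>y\<in>set ys. f x y * g y z :: 'c :: comm_semiring_0)"
proof (intro eq_matI)
  fix i k
  assume "i < dim_row (fun_mat xs zs (\<lambda>x z. \<Sum>y\<in>set ys. f x y * g y z))"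
    and "k < dim_col (fun_mat xs zs (\<lambda>x z. \<Sum>y\<in>set ys. f x y * g y z))"
  then have i: "i < length xs" and k: "k < length zs"
    by simp_all
  have "(\<Sum>j = 0..<length ys. f (xs ! i) (ys ! j) * g (ys ! j) (zs ! k)) =
      (\<Sum>y\<in>set ys. f (xs ! i) y * g y (zs ! k))"
    by (rule sum.reindex_bij_betw)
      (use assms in \<open>auto simp: bij_betw_def inj_on_nth set_conv_nth\<close>)
  then show "(fun_mat xs ys f * fun_mat ys zs g) $$ (i, k) =
      fun_mat xs zs (\<lambda>x z. \<Sum>y\<in>set ys. f x y * g y z) $$ (i, k)"
    using i k by (simp add: scalar_prod_def)
qed simp_all

lemma one_mat_eq_fun_mat: "distinct xs \<Longrightarrow> 1\<^sub>m (length xs) = fun_mat xs xs (\<lambda>x y. of_bool (x = y))"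
  by (intro eq_matI) (auto simp: nth_eq_iff_index_eq)

text \<open>Two enumerations of one set differ by a permutation, and the Kronecker deltas
  \<open>?P\<close> and \<open>?Q\<close> are the permutation matrices of the conjugation.\<close>

lemma similar_fun_mat:
  fixes f :: "'a \<Rightarrow> 'a \<Rightarrow> 'c :: comm_ring_1"
  assumes "distinct xs" "distinct ys" "set xs = set ys"
  shows "similar_mat (fun_mat xs xs f) (fun_mat ys ys f)"
proof (rule similar_matI)
  let ?P = "fun_mat xs ys (\<lambda>x y. of_bool (x = y)) :: 'c mat"
  let ?Q = "fun_mat ys xs (\<lambda>x y. of_bool (x = y)) :: 'c mat"
  have len: "length xs = length ys"
    using assms by (metis distinct_card)
  have [simp]: "(\<Sum>y\<in>set ys. of_bool (x = y) * h y) = h x"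
    "(\<Sum>y\<in>set ys. h y * of_bool (y = x)) = h x" if "x \<in> set ys" for x and h :: "'a \<Rightarrow> 'c"
    using that by (simp_all add: of_bool_def if_distrib if_distribR sum.delta sum.delta' cong: if_cong)
  show "{fun_mat xs xs f, fun_mat ys ys f, ?P, ?Q} \<subseteq> carrier_mat (length xs) (length xs)"
    by (auto simp: fun_mat_def len)
  show "?P * ?Q = 1\<^sub>m (length xs)"
    using assms by (auto simp: fun_mat_mult one_mat_eq_fun_mat intro!: fun_mat_cong)
  show "?Q * ?P = 1\<^sub>m (length xs)"
    using assms by (auto simp: fun_mat_mult one_mat_eq_fun_mat len intro!: fun_mat_cong)
  show "fun_mat xs xs f = ?P * fun_mat ys ys f * ?Q"
    using assms by (auto simp: fun_mat_mult intro!: fun_mat_cong)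
qed

lemma eigenvalue_mset_fun_mat_reorder:
  assumes "distinct xs" "distinct ys" "set xs = set ys"
  shows "eigenvalue_mset (fun_mat xs xs f) = eigenvalue_mset (fun_mat ys ys f)"
  using char_poly_similar[OF similar_fun_mat[OF assms, of f]]
  by (simp add: eigenvalue_mset_eq[of _ "length xs"] eigenvalue_mset_eq[of _ "length ys"])

text \<open>The matrix is block lower triangular along the split of the list.\<close>

lemma eigenvalue_mset_fun_mat_append:
  assumes "\<And>x y. x \<in> set xs \<Longrightarrow> y \<in> set ys \<Longrightarrow> f x y = 0"
  shows "eigenvalue_mset (fun_mat (xs @ ys) (xs @ ys) f) =
    eigenvalue_mset (fun_mat xs xs f) + eigenvalue_mset (fun_mat ys ys f)"
proof -
  have "fun_mat (xs @ ys) (xs @ ys) f =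
      four_block_mat (fun_mat xs xs f) (0\<^sub>m (length xs) (length ys)) (fun_mat ys xs f) (fun_mat ys ys f)"
    using assms by (intro eq_matI) (auto simp: nth_append)
  then have "char_poly (fun_mat (xs @ ys) (xs @ ys) f) =
      char_poly (fun_mat xs xs f) * char_poly (fun_mat ys ys f)"
    by (simp add: char_poly_four_block_upper_right_zero)
  then show ?thesis
    using proots_char_poly_mult[of "fun_mat xs xs f" "length xs" "fun_mat ys ys f" "length ys"]
    by (simp only: eigenvalue_mset_eq[OF fun_mat_carrier] fun_mat_carrier)
qed

lemma eigenvalue_mset_fun_mat_singleton: "eigenvalue_mset (fun_mat [x] [x] f) = {#of_real (f x x)#}"
proof -
  have "char_poly (fun_mat [x] [x] f) = [:- f x x, 1:]"
    by (subst char_poly_upper_triangular[of _ 1]) (auto simp: fun_mat_def diag_mat_def)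
  then show ?thesis
    by (simp add: eigenvalue_mset_eq[of _ 1] fun_mat_def)
qed

section \<open>Distances\<close>

text \<open>With unit weights the cost of a walk is its length, so a shortest walk attains the
  infimum that defines \<open>\<mu>\<close>.\<close>

lemma graph_dist_eqI:
  assumes G: "pair_wf_digraph G" and p: "pre_digraph.awalk (with_proj G) u p v"
    and min: "\<And>q. pre_digraph.awalk (with_proj G) u q v \<Longrightarrow> length p \<le> length q"
  shows "graph_dist G u v = length p"
proof -
  interpret pair_wf_digraph G by fact
  have cost: "awalk_cost (\<lambda>_. 1) q = real (length q)" for q
    by (induction q) auto
  have "\<mu> (\<lambda>_. 1) u v = ereal (length p)"
    unfolding \<mu>_def cost using p min by (intro INF_eqI) auto
  then show ?thesis
    by (simp add: graph_dist_def)
qed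

lemma graph_dist_refl:
  assumes "pair_wf_digraph G" "u \<in> pverts G"
  shows "graph_dist G u u = 0"
proof -
  interpret pair_wf_digraph G by fact
  show ?thesis
    using graph_dist_eqI[of G u "[]" u] assms by (simp add: awalk_Nil_iff)
qed

lemma graph_dist_arc:
  assumes "pair_wf_digraph G" "(u, v) \<in> parcs G" "u \<noteq> v"
  shows "graph_dist G u v = 1"
proof -
  interpret pair_wf_digraph G by fact
  have "1 \<le> length q" if "awalk u q v" for q
    using that assms(3) by (cases q) (auto simp: awalk_Nil_iff)
  then show ?thesis
    using graph_dist_eqI[of G u "[(u, v)]" v] assms wellformed'[of u v]
    by (simp add: awalk_Cons_iff awalk_Nil_iff)
qed

lemma graph_dist_two:
  assumes "pair_wf_digraph G" "(u, w) \<in> parcs G" "(w, v) \<in> parcs G" "(u, v) \<notin> parcs G" "u \<noteq> v"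
  shows "graph_dist G u v = 2"
proof -
  interpret pair_wf_digraph G by fact
  have "Suc (Suc 0) \<le> length q" if "awalk u q v" for q
  \<comment> \<open>This rule distinguishes lists of length 0, of length 1 and of length at least 2.
    The first would force \<open>u = v\<close>, the second an arc from \<open>u\<close> to
    \<open>v\<close>.\<close>
  proof (cases q rule: remdups_adj.cases)
    case (2 e)
    then show ?thesis
      using that assms(4) by (cases e) (auto simp: awalk_Cons_iff awalk_Nil_iff)
  qed (use that assms(5) in \<open>auto simp: awalk_Nil_iff\<close>)
  then show ?thesis
    using graph_dist_eqI[of G u "[(u, w), (w, v)]" v] assms wellformed'[of u w] wellformed'[of w v]
    by (simp add: awalk_Cons_iff awalk_Nil_iff)
qed

lemma card_neighbours:
  assumes "regular_graph k G" "u \<in> pverts G"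
  shows "card {v. (u, v) \<in> parcs G} = k"
proof -
  have "out_arcs (with_proj G) u = Pair u ` {v. (u, v) \<in> parcs G}"
    by (auto simp: out_arcs_def)
  moreover have "out_degree (with_proj G) u = k"
    using assms by (simp add: regular_graph_def)
  ultimately show ?thesis
    by (simp add: out_degree_def card_image inj_on_def)
qed

section \<open>The join of a regular graph with a union of two regular graphs\<close>

theorem theorem6p2:
  fixes G :: "nat \<Rightarrow> 'a pair_pre_digraph"
    and n k :: "nat \<Rightarrow> nat"
    and lam :: "nat \<Rightarrow> nat \<Rightarrow> real"
    and vs :: "nat \<Rightarrow> 'a list"
    and ws :: "'a list"
  assumes graph: "\<And>r. r \<in> {0, 1, 2} \<Longrightarrow> pair_graph (G r)"
    and disjoint: "\<And>r s. \<lbrakk>r \<in> {0, 1, 2}; s \<in> {0, 1, 2}; r \<noteq> s\<rbrakk> \<Longrightarrow> pverts (G r) \<inter> pverts (G s) = {}"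
    and order: "\<And>r. r \<in> {0, 1, 2} \<Longrightarrow> card (pverts (G r)) = n r"
    and nonempty: "\<And>r. r \<in> {0, 1, 2} \<Longrightarrow> n r \<ge> 1"
    and regular: "\<And>r. r \<in> {0, 1, 2} \<Longrightarrow> regular_graph (k r) (G r)"
    and enum: "\<And>r. r \<in> {0, 1, 2} \<Longrightarrow> vertex_enum (G r) (vs r)"
    and adjacency_eigenvalues: "\<And>r. r \<in> {0, 1, 2} \<Longrightarrow>
      eigenvalue_mset (adjacency_matrix (vs r) (G r)) =
        image_mset (\<lambda>t. complex_of_real (lam r t)) (mset_set {1..n r})"
    and largest: "\<And>r. r \<in> {0, 1, 2} \<Longrightarrow> lam r 1 = real (k r)"
    and decreasing: "\<And>r s t. \<lbrakk>r \<in> {0, 1, 2}; 1 \<le> s; s \<le> t; t \<le> n r\<rbrakk> \<Longrightarrow> lam r t \<le> lam r s"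
    and enum_join: "vertex_enum (graph_join (G 0) (graph_union (G 1) (G 2))) ws"
  shows "eigenvalue_mset (distance_seidel_matrix ws (graph_join (G 0) (graph_union (G 1) (G 2)))) =
    (\<Sum>r\<in>{0, 1, 2}. image_mset (\<lambda>t. complex_of_real (3 + 2 * lam r t)) (mset_set {2..n r})) +
    eigenvalue_mset (mat_of_rows_list 3
      [[3 - 3 * real (n 0) + 2 * real (k 0), - real (n 1), - real (n 2)],
       [- real (n 0), 3 - 3 * real (n 1) + 2 * real (k 1), - 3 * real (n 2)],
       [- real (n 0), - 3 * real (n 1), 3 - 3 * real (n 2) + 2 * real (k 2)]])"
proof -
  let ?H = "graph_join (G 0) (graph_union (G 1) (G 2))"
  let ?L = "[0, 1, 2] :: nat list"
  let ?V = "pverts (G 0) \<union> pverts (G 1) \<union> pverts (G 2)"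
  let ?E = "parcs (G 0) \<union> parcs (G 1) \<union> parcs (G 2)"
  \<comment> \<open>The label of the block containing \<open>u\<close>; vertices outside all three
    graphs get the default 2.\<close>
  define b :: "'a \<Rightarrow> nat" where
    "b u = (if u \<in> pverts (G 0) then 0 else if u \<in> pverts (G 1) then 1 else 2)" for u
  define x :: "'a \<Rightarrow> 'a \<Rightarrow> real" where
    "x u v = 3 * of_bool (u = v) + 2 * of_bool ((u, v) \<in> ?E)" for u v
  \<comment> \<open>Off the diagonal a Seidel entry is -1 at distance 1 and -3 at distance 2. Within
    one side of the join, subtracting 3 from \<open>x\<close> gives -1 on arcs, -3 on non-arcs and 0
    on the diagonal; across the join \<open>x\<close> is 0, and subtracting 1 gives -1.\<close>
  define c :: "nat \<Rightarrow> nat \<Rightarrow> real" where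
    "c r s = (if (r = 0) = (s = 0) then 3 else 1)" for r s
  define y :: "nat \<Rightarrow> nat \<Rightarrow> real" where
    "y r s = (if r = s then 3 + 2 * real (k r) else 0)" for r s

  \<comment> \<open>Block labels and arcs\<close>
  have wf: "pair_wf_digraph (G r)" if "r \<in> {0, 1, 2}" for r
    using graph[OF that] by (simp add: pair_graph_def pair_digraph_def pair_fin_digraph_def)
  have arc_verts: "u \<in> pverts (G r) \<and> v \<in> pverts (G r)"
    if "r \<in> {0, 1, 2}" "(u, v) \<in> parcs (G r)" for r u v
    using pair_wf_digraph.wellformed'[OF wf[OF that(1)] that(2)] by simp
  have loopfree: "u \<noteq> v" if "r \<in> {0, 1, 2}" "(u, v) \<in> parcs (G r)" for r u v
    using graph[OF that(1)] that(2) pair_loopfree_digraph.pair_no_loops[of "G r" "(u, v)"]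
    by (auto simp: pair_graph_def pair_digraph_def)
  have b: "b u = r" if "r \<in> {0, 1, 2}" "u \<in> pverts (G r)" for r u
    using that disjoint[of 0 1] disjoint[of 0 2] disjoint[of 1 2] by (auto simp: b_def)
  have verts_b: "pverts (G r) = {u \<in> ?V. b u = r}" if "r \<in> {0, 1, 2}" for r
    using that disjoint[of 0 1] disjoint[of 0 2] disjoint[of 1 2]
    by (auto simp: b_def split: if_splits)
  have b_range: "b u \<in> {0, 1, 2}" for u
    by (simp add: b_def)
  have in_verts_b: "u \<in> pverts (G (b u))" if "u \<in> ?V" for u
    using that by (auto simp: b_def)
  have arc_b: "b u = b v" if "(u, v) \<in> ?E" for u v
    using that arc_verts b by (metis UnE insertCI)
  \<comment> \<open>This holds even for \<open>u\<close> outside \<open>?V\<close>, where both sides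
    are false.\<close>
  have arc_iff: "(u, v) \<in> ?E \<longleftrightarrow> (u, v) \<in> parcs (G (b u))" for u v
    using b_range[of u] b arc_verts by (metis UnCI UnE insertCI insertE singletonD)
  have arc_end: "v \<in> ?V \<and> b v = b u" if "(u, v) \<in> parcs (G (b u))" for u v
    using arc_verts[OF b_range that] b[OF b_range] verts_b[OF b_range] by blast
  have ws: "distinct ws" "set ws = ?V"
    using enum_join by (auto simp: vertex_enum_def graph_join_def graph_union_def)
  have vs: "distinct (vs r)" "set (vs r) = pverts (G r)" if "r \<in> {0, 1, 2}" for r
    using enum[OF that] by (auto simp: vertex_enum_def)

  \<comment> \<open>Distances in the join\<close>
  have wf_H: "pair_wf_digraph ?H"
    using arc_verts by unfold_locales (auto simp: graph_join_def graph_union_def)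
  have arc_H: "(u, v) \<in> parcs ?H \<longleftrightarrow> (u, v) \<in> ?E \<or> (b u = 0) \<noteq> (b v = 0)"
    if "u \<in> ?V" "v \<in> ?V" for u v
    using that disjoint[of 0 1] disjoint[of 0 2]
    by (auto simp: b_def graph_join_def graph_union_def split: if_splits)
  have dist_H: "1 - of_bool (u = v) - 2 * graph_dist ?H u v = x u v - c (b u) (b v)"
    if uv: "u \<in> ?V" "v \<in> ?V" for u v
  proof (cases "u = v")
    case True
    then show ?thesis
      using graph_dist_refl[OF wf_H, of u] uv loopfree
      by (auto simp: x_def c_def graph_join_def graph_union_def)
  next
    case neq: False
    show ?thesis
    proof (cases "(u, v) \<in> parcs ?H")
      case True
      then show ?thesis
        using graph_dist_arc[OF wf_H True neq] arc_H[OF uv] arc_b[of u v] neq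
        by (auto simp: x_def c_def)
    next
      case False
      \<comment> \<open>Nonadjacent \<open>u\<close> and \<open>v\<close> lie on the same side of
        the join. Both sides have a vertex, and the one opposite to \<open>u\<close> is a common
        neighbour.\<close>
      obtain w0 w1 where "w0 \<in> pverts (G 0)" "w1 \<in> pverts (G 1)"
        using nonempty[of 0] nonempty[of 1] order[of 0] order[of 1]
        by (metis card.empty equals0I insertCI not_one_le_zero)
      then obtain w where w: "w \<in> ?V" "(b w = 0) \<noteq> (b u = 0)"
        using b[of 0 w0] b[of 1 w1] that[of w0] that[of w1] by (cases "b u = 0") auto
      have "(u, w) \<in> parcs ?H" "(w, v) \<in> parcs ?H"
        using w False arc_H uv by blast+
      then show ?thesis
        using graph_dist_two[OF wf_H _ _ False neq] arc_H[OF uv] False neq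
        by (auto simp: x_def c_def)
    qed
  qed

  \<comment> \<open>The low-rank decomposition and the quotient matrix\<close>
  let ?X = "fun_mat ws ws x" and ?Y = "fun_mat ?L ?L y"
  let ?U = "fun_mat ws ?L (\<lambda>u r. of_bool (b u = r)) :: real mat"
  let ?W = "fun_mat ?L ws (\<lambda>r v. - c r (b v))"
  let ?T = "mat_of_rows_list 3
      [[3 - 3 * real (n 0) + 2 * real (k 0), - real (n 1), - real (n 2)],
       [- real (n 0), 3 - 3 * real (n 1) + 2 * real (k 1), - 3 * real (n 2)],
       [- real (n 0), - 3 * real (n 1), 3 - 3 * real (n 2) + 2 * real (k 2)]]"
  have L: "distinct ?L"
    by simp
  \<comment> \<open>Left multiplication by \<open>?U\<close> selects the row with label
    \<open>b u\<close>; this evaluates both \<open>?U * ?W\<close> and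
    \<open>?U * ?Y\<close>.\<close>
  have sum_L: "(\<Sum>r\<in>set ?L. of_bool (b u = r) * h r) = h (b u)" for u and h :: "nat \<Rightarrow> real"
    using b_range[of u] by auto
  have fin: "finite ?V"
    using ws by (metis finite_set)

  have "distance_seidel_matrix ws ?H =
      fun_mat ws ws (\<lambda>u v. 1 - of_bool (u = v) - 2 * graph_dist ?H u v)"
    using ws by (intro eq_matI)
      (auto simp: distance_seidel_matrix_def distance_matrix_def nth_eq_iff_index_eq)
  also have "\<dots> = fun_mat ws ws (\<lambda>u v. x u v - c (b u) (b v))"
    using dist_H ws by (intro fun_mat_cong) blast
  also have "\<dots> = ?X + ?U * ?W"
    unfolding fun_mat_mult[OF L] fun_mat_add sum_L by simp
  finally have seidel: "distance_seidel_matrix ws ?H = ?X + ?U * ?W" .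

  have "?X * ?U = fun_mat ws ?L (\<lambda>u r. \<Sum>v\<in>?V. x u v * of_bool (b v = r))"
    using ws by (simp add: fun_mat_mult)
  also have "\<dots> = fun_mat ws ?L (\<lambda>u r. y (b u) r)"
  proof (rule fun_mat_cong)
    fix u r
    assume u: "u \<in> set ws" and r: "r \<in> set ?L"
    \<comment> \<open>Neighbours of \<open>u\<close> in block \<open>r\<close>: all
      \<open>k r\<close> of them if \<open>u\<close> lies in that block, otherwise none. Hence the
      row sums of \<open>?X\<close> over a block depend only on the label of
      \<open>u\<close>.\<close>
    let ?N = "{v \<in> ?V. (u, v) \<in> ?E \<and> b v = r}"
    have "v \<in> ?V \<and> (u, v) \<in> ?E \<and> b v = r \<longleftrightarrow> b u = r \<and> (u, v) \<in> parcs (G (b u))" for v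
      unfolding arc_iff using arc_end[of u v] by metis
    then have "?N = (if b u = r then {v. (u, v) \<in> parcs (G (b u))} else {})"
      by (cases "b u = r") (simp_all only: empty_def if_True if_False simp_thms)
    moreover have "card {v. (u, v) \<in> parcs (G (b u))} = k (b u)"
      using card_neighbours[OF regular[OF b_range] in_verts_b] u ws by simp
    ultimately have N: "real (card ?N) = (if b u = r then real (k r) else 0)"
      by auto
    have "(\<Sum>v\<in>?V. x u v * of_bool (b v = r)) =
        (\<Sum>v\<in>?V. (if u = v then 3 * of_bool (b v = r) else 0) + 2 * of_bool ((u, v) \<in> ?E \<and> b v = r))"
      by (intro sum.cong) (auto simp: x_def)
    also have "\<dots> = 3 * of_bool (b u = r) + 2 * real (card ?N)"
      using fin u ws by (simp add: sum.distrib flip: sum_distrib_left) (simp add: Int_def)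
    also have "\<dots> = y (b u) r"
      unfolding N y_def by simp
    finally show "(\<Sum>v\<in>?V. x u v * of_bool (b v = r)) = y (b u) r" .
  qed
  also have "\<dots> = ?U * ?Y"
    unfolding fun_mat_mult[OF L] sum_L ..
  finally have XU: "?X * ?U = ?U * ?Y" .

  have "?W * ?U = fun_mat ?L ?L (\<lambda>r s. \<Sum>v\<in>?V. - c r (b v) * of_bool (b v = s))"
    using ws by (simp add: fun_mat_mult)
  also have "\<dots> = fun_mat ?L ?L (\<lambda>r s. - c r s * real (n s))"
  proof (rule fun_mat_cong)
    fix r s
    assume s: "s \<in> set ?L"
    \<comment> \<open>The row of \<open>?W\<close> is constant on block \<open>s\<close>, so the sum
      only counts the vertices of that block.\<close>
    have "(\<Sum>v\<in>?V. - c r (b v) * of_bool (b v = s)) = (\<Sum>v\<in>?V. if b v = s then - c r s else 0)"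
      by (intro sum.cong) auto
    also have "\<dots> = - c r s * real (card {v \<in> ?V. b v = s})"
      using fin by (simp flip: sum.inter_filter)
    also have "{v \<in> ?V. b v = s} = pverts (G s)"
      using s by (intro verts_b[symmetric]) simp
    finally show "(\<Sum>v\<in>?V. - c r (b v) * of_bool (b v = s)) = - c r s * real (n s)"
      using order[of s] s by simp
  qed
  finally have "?Y + ?W * ?U = fun_mat ?L ?L (\<lambda>r s. y r s - c r s * real (n s))"
    by (simp add: fun_mat_add)
  also have "\<dots> = ?T"
    by (intro eq_matI)
      (auto simp: mat_of_rows_list_def y_def c_def less_Suc_eq numeral_3_eq_3 numeral_2_eq_2)
  finally have T: "?Y + ?W * ?U = ?T" .

  have "char_poly (?X + ?U * ?W) * char_poly ?Y = char_poly ?X * char_poly (?Y + ?W * ?U)"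
    using XU by (intro char_poly_intertwine[OF fun_mat_carrier fun_mat_carrier fun_mat_carrier fun_mat_carrier])
  then have "proots (map_poly complex_of_real (char_poly (?X + ?U * ?W) * char_poly ?Y)) =
      proots (map_poly complex_of_real (char_poly ?X * char_poly (?Y + ?W * ?U)))"
    by simp
  then have split: "eigenvalue_mset (distance_seidel_matrix ws ?H) + eigenvalue_mset ?Y =
      eigenvalue_mset ?X + eigenvalue_mset ?T"
    unfolding seidel T[symmetric]
    by (subst (asm) (1 2) proots_char_poly_mult[of _ "length ws" _ 3]) (auto simp: fun_mat_def)

  \<comment> \<open>Spectra of the diagonal matrix and of the disjoint union\<close>
  have y_diag: "y r r = 3 + 2 * real (k r)" for r
    by (simp add: y_def)
  \<comment> \<open>The index list is written as a concatenation so that the diagonal matrix splits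
    into blocks of size 1.\<close>
  have "eigenvalue_mset (fun_mat ([0] @ [1, 2]) ([0] @ [1, 2]) y) =
      eigenvalue_mset (fun_mat [0] [0] y) + eigenvalue_mset (fun_mat ([1] @ [2]) ([1] @ [2]) y)"
    by (subst eigenvalue_mset_fun_mat_append) (auto simp: y_def)
  also have "eigenvalue_mset (fun_mat ([1] @ [2]) ([1] @ [2]) y) =
      eigenvalue_mset (fun_mat [1] [1] y) + eigenvalue_mset (fun_mat [2] [2] y)"
    by (intro eigenvalue_mset_fun_mat_append) (simp add: y_def)
  finally have eig_Y: "eigenvalue_mset ?Y = (\<Sum>r\<in>{0, 1, 2}. {#complex_of_real (3 + 2 * real (k r))#})"
    by (simp add: eigenvalue_mset_fun_mat_singleton y_diag)

  have eig_block: "eigenvalue_mset (fun_mat (vs r) (vs r) x) =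
      image_mset (\<lambda>t. complex_of_real (3 + 2 * lam r t)) (mset_set {2..n r}) +
      {#complex_of_real (3 + 2 * real (k r))#}"
    if r: "r \<in> {0, 1, 2}" for r
  proof -
    have "x u v = 3 * of_bool (u = v) + 2 * (if (u, v) \<in> parcs (G r) then 1 else 0)"
      if "u \<in> set (vs r)" for u v
      using b[OF r, of u] that unfolding x_def arc_iff by (simp add: vs(2)[OF r])
    then have "fun_mat (vs r) (vs r) x = 3 \<cdot>\<^sub>m 1\<^sub>m (length (vs r)) + 2 \<cdot>\<^sub>m adjacency_matrix (vs r) (G r)"
      using vs(1)[OF r] by (intro eq_matI) (auto simp: adjacency_matrix_def nth_eq_iff_index_eq)
    then have "eigenvalue_mset (fun_mat (vs r) (vs r) x) =
        image_mset (\<lambda>z. of_real 3 + of_real 2 * z) (eigenvalue_mset (adjacency_matrix (vs r) (G r)))"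
      using eigenvalue_mset_affine[of "adjacency_matrix (vs r) (G r)" "length (vs r)" 3 2]
      by (simp add: adjacency_matrix_def)
    also have "\<dots> = image_mset (\<lambda>t. complex_of_real (3 + 2 * lam r t)) (mset_set {1..n r})"
      by (simp add: adjacency_eigenvalues[OF r] multiset.map_comp comp_def)
    \<comment> \<open>The index 1 carries \<open>lam r 1 = k r\<close>; it is split off as the
      eigenvalue shared with \<open>?Y\<close>.\<close>
    also have "{1..n r} = insert 1 {2..n r}"
      using nonempty[OF r] by auto
    finally show ?thesis
      using largest[OF r] by simp
  qed

  have x_cross: "x u v = 0"
    if "r \<in> {0, 1, 2}" "s \<in> {0, 1, 2}" "r \<noteq> s" "u \<in> pverts (G r)" "v \<in> pverts (G s)" for r s u v
    using that b[of r u] b[of s v] arc_b[of u v] by (auto simp: x_def)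
  let ?vs = "vs 0 @ vs 1 @ vs 2"
  \<comment> \<open>The enumeration \<open>ws\<close> may mix the three graphs; listing them one
    after another makes the matrix block diagonal.\<close>
  have "eigenvalue_mset ?X = eigenvalue_mset (fun_mat ?vs ?vs x)"
    using ws vs disjoint[of 0 1] disjoint[of 0 2] disjoint[of 1 2]
    by (intro eigenvalue_mset_fun_mat_reorder) auto
  also have "\<dots> = eigenvalue_mset (fun_mat (vs 0) (vs 0) x) +
      eigenvalue_mset (fun_mat (vs 1 @ vs 2) (vs 1 @ vs 2) x)"
    using vs x_cross[of 0 1] x_cross[of 0 2] by (intro eigenvalue_mset_fun_mat_append) auto
  also have "eigenvalue_mset (fun_mat (vs 1 @ vs 2) (vs 1 @ vs 2) x) =
      eigenvalue_mset (fun_mat (vs 1) (vs 1) x) + eigenvalue_mset (fun_mat (vs 2) (vs 2) x)"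
    using vs x_cross[of 1 2] by (intro eigenvalue_mset_fun_mat_append) auto
  finally have "eigenvalue_mset ?X = (\<Sum>r\<in>{0, 1, 2}. eigenvalue_mset (fun_mat (vs r) (vs r) x))"
    by simp
  also have "\<dots> = (\<Sum>r\<in>{0, 1, 2}. image_mset (\<lambda>t. complex_of_real (3 + 2 * lam r t)) (mset_set {2..n r})) +
      eigenvalue_mset ?Y"
    unfolding eig_Y sum.distrib[symmetric] by (intro sum.cong refl eig_block)
  \<comment> \<open>Addition of multisets is cancellative, so \<open>eigenvalue_mset ?Y\<close>
    drops out of both sides of \<open>split\<close>.\<close>
  finally show ?thesis
    using split by simp
qed

end
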